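(* Let $(A,+,\vee,\wedge,\ast,0)$ be an AL-monoid. Then the set of all invertible elements of $A$, with the operation $+$ and the lattice operations $\vee,\wedge$ of $A$, forms a lattice ordered group (l-group).
   Context: A commutative lattice ordered monoid $(A,+,\vee,\wedge,0)$ is a commutative monoid $(A,+)$ with identity element $0$ together with a lattice structure $(A,\vee,\wedge)$ such that $a+(b\vee c)=(a+b)\vee(a+c)$ and $a+(b\wedge c)=(a+b)\wedge(a+c)$ for all $a,b,c\in A$; $\leq$ denotes the lattice order. The element $0$ is not assumed to be the least element of $A$. An autometrized lattice ordered monoid (AL-monoid) is an algebra $(A,+,\vee,\wedge,\ast,0)$ of arity $(2,2,2,2,0)$ such that: (1) $(A,+,\vee,\wedge,0)$ is a commutative lattice ordered monoid; (2) $a\ast(a\wedge b)+b=a\vee b$ for all $a,b\in A$ (here $a\ast(a\wedge b)+b$ means $(a\ast(a\wedge b))+b$); (3) for each $a\in A$, the mappings $x\mapsto a+x$, $x\mapsto a\vee x$, $x\mapsto a\wedge x$ and $x\mapsto a\ast x$ are contractions with respect to $\ast$, where $f:A\to A$ is a contraction if $f(x)\ast f(y)\leq x\ast y$ for all $x,y\in A$; (4) $[a\ast(a\vee b)]\wedge[b\ast(a\vee b)]=0$ for all $a,b\in A$. An element $a\in A$ is invertible if there is $x\in A$ with $a+x=0$. *)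

theory Defs
  imports "HOL-Algebra.Group"
begin

text \<open>
  The algebras of this theory extend the record \<open>monoid\<close> of \<open>HOL-Algebra\<close>. The monoid operation,
  usually written \<open>+\<close> with identity \<open>0\<close>, is therefore written \<open>\<otimes>\<close> with identity \<open>\<one>\<close>.
\<close>

record 'a lattice_monoid = "'a monoid" +
  ljoin :: "'a \<Rightarrow> 'a \<Rightarrow> 'a" (infixl "\<curlyvee>\<index>" 65)
  lmeet :: "'a \<Rightarrow> 'a \<Rightarrow> 'a" (infixl "\<curlywedge>\<index>" 70)

record 'a autometrized_monoid = "'a lattice_monoid" +
  adist :: "'a \<Rightarrow> 'a \<Rightarrow> 'a" (infixl "\<star>\<index>" 75)

text \<open>
  A lattice given by its two operations, on the carrier only. (The locale \<open>lattice\<close> of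
  \<open>HOL-Algebra\<close> takes the order as primitive.)
\<close>

locale lattice_operations =
  fixes A :: "('a, 'm) lattice_monoid_scheme" (structure)
  assumes join_closed: "\<lbrakk>a \<in> carrier A; b \<in> carrier A\<rbrakk> \<Longrightarrow> a \<curlyvee> b \<in> carrier A"
    and meet_closed: "\<lbrakk>a \<in> carrier A; b \<in> carrier A\<rbrakk> \<Longrightarrow> a \<curlywedge> b \<in> carrier A"
    and join_comm: "\<lbrakk>a \<in> carrier A; b \<in> carrier A\<rbrakk> \<Longrightarrow> a \<curlyvee> b = b \<curlyvee> a"
    and meet_comm: "\<lbrakk>a \<in> carrier A; b \<in> carrier A\<rbrakk> \<Longrightarrow> a \<curlywedge> b = b \<curlywedge> a"
    and join_assoc: "\<lbrakk>a \<in> carrier A; b \<in> carrier A; c \<in> carrier A\<rbrakk>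
          \<Longrightarrow> (a \<curlyvee> b) \<curlyvee> c = a \<curlyvee> (b \<curlyvee> c)"
    and meet_assoc: "\<lbrakk>a \<in> carrier A; b \<in> carrier A; c \<in> carrier A\<rbrakk>
          \<Longrightarrow> (a \<curlywedge> b) \<curlywedge> c = a \<curlywedge> (b \<curlywedge> c)"
    and join_absorb: "\<lbrakk>a \<in> carrier A; b \<in> carrier A\<rbrakk> \<Longrightarrow> a \<curlyvee> (a \<curlywedge> b) = a"
    and meet_absorb: "\<lbrakk>a \<in> carrier A; b \<in> carrier A\<rbrakk> \<Longrightarrow> a \<curlywedge> (a \<curlyvee> b) = a"

definition lattice_le :: "('a, 'm) lattice_monoid_scheme \<Rightarrow> 'a \<Rightarrow> 'a \<Rightarrow> bool" (infix "\<preceq>\<index>" 50)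
  where "a \<preceq>\<^bsub>A\<^esub> b \<longleftrightarrow> a \<curlywedge>\<^bsub>A\<^esub> b = a"

locale comm_lattice_ordered_monoid = comm_monoid A + lattice_operations A
  for A :: "('a, 'm) lattice_monoid_scheme" (structure) +
  assumes mult_join_distrib: "\<lbrakk>a \<in> carrier A; b \<in> carrier A; c \<in> carrier A\<rbrakk>
          \<Longrightarrow> a \<otimes> (b \<curlyvee> c) = (a \<otimes> b) \<curlyvee> (a \<otimes> c)"
    and mult_meet_distrib: "\<lbrakk>a \<in> carrier A; b \<in> carrier A; c \<in> carrier A\<rbrakk>
          \<Longrightarrow> a \<otimes> (b \<curlywedge> c) = (a \<otimes> b) \<curlywedge> (a \<otimes> c)"

text \<open>
  The group is not required to be commutative, so distributivity is imposed on both sides.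
\<close>

locale lattice_ordered_group = group G + lattice_operations G
  for G :: "('a, 'm) lattice_monoid_scheme" (structure) +
  assumes mult_join_distrib_left: "\<lbrakk>a \<in> carrier G; b \<in> carrier G; c \<in> carrier G\<rbrakk>
          \<Longrightarrow> a \<otimes> (b \<curlyvee> c) = (a \<otimes> b) \<curlyvee> (a \<otimes> c)"
    and mult_join_distrib_right: "\<lbrakk>a \<in> carrier G; b \<in> carrier G; c \<in> carrier G\<rbrakk>
          \<Longrightarrow> (b \<curlyvee> c) \<otimes> a = (b \<otimes> a) \<curlyvee> (c \<otimes> a)"
    and mult_meet_distrib_left: "\<lbrakk>a \<in> carrier G; b \<in> carrier G; c \<in> carrier G\<rbrakk>
          \<Longrightarrow> a \<otimes> (b \<curlywedge> c) = (a \<otimes> b) \<curlywedge> (a \<otimes> c)"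
    and mult_meet_distrib_right: "\<lbrakk>a \<in> carrier G; b \<in> carrier G; c \<in> carrier G\<rbrakk>
          \<Longrightarrow> (b \<curlywedge> c) \<otimes> a = (b \<otimes> a) \<curlywedge> (c \<otimes> a)"

definition contraction :: "('a, 'm) autometrized_monoid_scheme \<Rightarrow> ('a \<Rightarrow> 'a) \<Rightarrow> bool"
  where "contraction A f \<longleftrightarrow> f \<in> carrier A \<rightarrow> carrier A \<and>
    (\<forall>x\<in>carrier A. \<forall>y\<in>carrier A. f x \<star>\<^bsub>A\<^esub> f y \<preceq>\<^bsub>A\<^esub> x \<star>\<^bsub>A\<^esub> y)"

locale AL_monoid = comm_lattice_ordered_monoid A
  for A :: "('a, 'm) autometrized_monoid_scheme" (structure) +
  assumes dist_closed: "\<lbrakk>a \<in> carrier A; b \<in> carrier A\<rbrakk> \<Longrightarrow> a \<star> b \<in> carrier A"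
    and dist_meet: "\<lbrakk>a \<in> carrier A; b \<in> carrier A\<rbrakk>
          \<Longrightarrow> (a \<star> (a \<curlywedge> b)) \<otimes> b = a \<curlyvee> b"
    and contraction_mult: "a \<in> carrier A \<Longrightarrow> contraction A (\<lambda>x. a \<otimes> x)"
    and contraction_join: "a \<in> carrier A \<Longrightarrow> contraction A (\<lambda>x. a \<curlyvee> x)"
    and contraction_meet: "a \<in> carrier A \<Longrightarrow> contraction A (\<lambda>x. a \<curlywedge> x)"
    and contraction_dist: "a \<in> carrier A \<Longrightarrow> contraction A (\<lambda>x. a \<star> x)"
    and dist_join_disjoint: "\<lbrakk>a \<in> carrier A; b \<in> carrier A\<rbrakk>
          \<Longrightarrow> (a \<star> (a \<curlyvee> b)) \<curlywedge> (b \<star> (a \<curlyvee> b)) = \<one>"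

definition invertible_elements :: "('a, 'm) monoid_scheme \<Rightarrow> 'a set"
  where "invertible_elements A = {a \<in> carrier A. \<exists>x\<in>carrier A. a \<otimes>\<^bsub>A\<^esub> x = \<one>\<^bsub>A\<^esub>}"

end

theory Submission imports Defs "HOL-Algebra.Divisibility"
begin

text \<open>
  In any commutative lattice ordered monoid \<open>(a \<curlyvee> b) \<otimes> (a \<curlywedge> b) = a \<otimes> b\<close>: expanding the join on the
  left gives a join of two elements below \<open>a \<otimes> b\<close>, and expanding the meet gives a meet of two
  elements above it. A factor of an invertible element is invertible, so the invertible elements
  are closed under both lattice operations.
\<close>

context comm_lattice_ordered_monoid
begin

lemma join_mult_meet:
  assumes a: "a \<in> carrier A" and b: "b \<in> carrier A"
  shows "(a \<curlyvee> b) \<otimes> (a \<curlywedge> b) = a \<otimes> b"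
proof -
  let ?s = "a \<curlyvee> b" and ?m = "a \<curlywedge> b"
  have s: "?s \<in> carrier A" and m: "?m \<in> carrier A"
    using a b by (simp_all add: join_closed meet_closed)
  have mb: "?m \<curlyvee> b = b" and ma: "?m \<curlyvee> a = a"
    using a b m join_absorb[OF a b] join_absorb[OF b a] by (simp_all add: join_comm meet_comm)
  have sb: "?s \<curlywedge> b = b" and sa: "?s \<curlywedge> a = a"
    using a b s meet_absorb[OF a b] meet_absorb[OF b a] by (simp_all add: join_comm meet_comm)
  have upper: "?s \<otimes> ?m \<curlyvee> a \<otimes> b = a \<otimes> b"
  proof -
    have "?s \<otimes> ?m = a \<otimes> ?m \<curlyvee> b \<otimes> ?m"
      using mult_join_distrib[OF m a b] a b s m by (simp add: m_comm)
    moreover have "a \<otimes> ?m \<curlyvee> a \<otimes> b = a \<otimes> b"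
      using mult_join_distrib[OF a m b] mb by simp
    moreover have "b \<otimes> ?m \<curlyvee> a \<otimes> b = a \<otimes> b"
      using mult_join_distrib[OF b m a] ma m_comm[OF a b] by simp
    ultimately show ?thesis
      using a b m by (simp add: join_assoc)
  qed
  have lower: "?s \<otimes> ?m \<curlywedge> (a \<otimes> b) = a \<otimes> b"
  proof -
    have "?s \<otimes> ?m = a \<otimes> ?s \<curlywedge> (b \<otimes> ?s)"
      using mult_meet_distrib[OF s a b] a b s by (simp add: m_comm)
    moreover have "a \<otimes> ?s \<curlywedge> (a \<otimes> b) = a \<otimes> b"
      using mult_meet_distrib[OF a s b] sb by simp
    moreover have "b \<otimes> ?s \<curlywedge> (a \<otimes> b) = a \<otimes> b"
      using mult_meet_distrib[OF b s a] sa m_comm[OF a b] by simp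
    ultimately show ?thesis
      using a b s by (simp add: meet_assoc)
  qed
  \<comment> \<open>Antisymmetry: by \<open>upper\<close>, absorption says that the meet of
    \<open>?s \<otimes> ?m\<close> with \<open>a \<otimes> b\<close> is
    \<open>?s \<otimes> ?m\<close>; by \<open>lower\<close> it is
    \<open>a \<otimes> b\<close>.\<close>
  show ?thesis
    using meet_absorb[of "?s \<otimes> ?m" "a \<otimes> b"] upper lower a b s m by simp
qed

text \<open>Commutativity makes a one-sided inverse two-sided.\<close>

lemma invertible_elements_eq_Units: "invertible_elements A = Units A"
  unfolding invertible_elements_def Units_def using m_comm by fastforce

lemma Units_join_meet:
  assumes "a \<in> Units A" "b \<in> Units A"
  shows "a \<curlyvee> b \<in> Units A" "a \<curlywedge> b \<in> Units A"
proof -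
  have a: "a \<in> carrier A" and b: "b \<in> carrier A"
    using assms by (simp_all add: Units_closed)
  have "(a \<curlyvee> b) \<otimes> (a \<curlywedge> b) \<in> Units A"
    using assms by (simp add: join_mult_meet[OF a b])
  \<comment> \<open>\<open>unit_factor\<close> treats only the left factor, hence two instances with
    the order swapped.\<close>
  then show "a \<curlyvee> b \<in> Units A" "a \<curlywedge> b \<in> Units A"
    using unit_factor[of "a \<curlyvee> b" "a \<curlywedge> b"] unit_factor[of "a \<curlywedge> b" "a \<curlyvee> b"]
      join_closed[OF a b] meet_closed[OF a b] by (simp_all add: m_comm)
qed

text \<open>The operations are those of \<open>A\<close>, so all identities restrict to
  \<open>Units A\<close>; only closure and inverses remain.\<close>

lemma lattice_ordered_group_Units: "lattice_ordered_group (A\<lparr>carrier := Units A\<rparr>)"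
proof -
  let ?G = "A\<lparr>carrier := Units A\<rparr>"
  interpret G: group ?G
    by (rule groupI) (auto simp: m_assoc Units_closed intro: Units_l_inv)
  interpret G: lattice_operations ?G
    by unfold_locales
      (simp_all add: Units_join_meet Units_closed join_assoc meet_assoc join_absorb meet_absorb,
        simp_all add: Units_closed join_comm meet_comm)
  show ?thesis
    \<comment> \<open>Commutativity reduces the right distributive laws to the left ones.\<close>
    by unfold_locales
      (simp_all add: Units_closed mult_join_distrib mult_meet_distrib m_comm[of _ a for a]
        join_closed meet_closed)
qed

end

theorem theorem3p2:
  fixes A :: "('a, 'm) autometrized_monoid_scheme"
  assumes "AL_monoid A"
  shows "lattice_ordered_group (A\<lparr>carrier := invertible_elements A\<rparr>)"
proof -
  interpret AL_monoid A by fact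
  show ?thesis
    using lattice_ordered_group_Units by (simp add: invertible_elements_eq_Units)
qed

end
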